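(* There is a constant $C=C(n)$ such that, for every stable solution $u:\mathbb R^n\to\mathbb R$ to the Allen–Cahn equation, every $e\in\mathbb S^{n-1}$ and every $R>0$, $$\mathbf K_R^2(u,e)\le C\,\mathbf T_{2R}^2(u,e).$$
   Context: $W(s)=\frac14(1-s^2)^2$. A solution to the Allen–Cahn equation on $\mathbb R^n$ is a $C^2$ function with $-\Delta u+W'(u)=0$; it is stable if $\int_{\mathbb R^n}|\nabla\xi|^2+W''(u)\xi^2\,dx\ge0$ for all $\xi\in C^1_c(\mathbb R^n)$. For $e\in\mathbb S^{n-1}$ let $\nabla^{e'}u=\nabla u-(e\cdot\nabla u)e$, and $$\mathcal A_e'^2(u)=\frac{|D\nabla^{e'}u|^2-|\nabla|\nabla^{e'}u||^2}{|\nabla u|^2}\ \text{ where }\nabla^{e'}u\ne0,\qquad \mathcal A_e'^2(u)=0\ \text{ otherwise},$$ where $D\nabla^{e'}u$ is the differential matrix of the vector field $\nabla^{e'}u$. Define $$\mathbf K_r^2(u,e)=\frac1{r^{n-3}}\int_{B_r}\mathcal A_e'^2(u)|\nabla u|^2,\qquad \mathbf T_r^2(u,e)=\frac1{r^{n-1}}\int_{B_r}\left(1-\left(e\cdot\tfrac{\nabla u}{|\nabla u|}\right)^2\right)|\nabla u|^2 ,$$ where the last integrand is understood as $|\nabla u|^2-(e\cdot\nabla u)^2$. *)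

theory Defs
  imports "HOL-Analysis.Analysis"
begin

definition W :: "real \<Rightarrow> real" where
  "W s = 1 / 4 * (1 - s\<^sup>2)\<^sup>2"

lemma deriv_W: "deriv W = (\<lambda>s. s ^ 3 - s)"
proof
  fix s :: real
  have "(W has_field_derivative s ^ 3 - s) (at s)"
    unfolding W_def [abs_def]
    by (auto intro!: derivative_eq_intros simp: field_simps power2_eq_square power3_eq_cube)
  then show "deriv W s = s ^ 3 - s"
    by (rule DERIV_imp_deriv)
qed

lemma deriv_deriv_W: "deriv (deriv W) s = 3 * s\<^sup>2 - 1"
  unfolding deriv_W
  by (rule DERIV_imp_deriv) (auto intro!: derivative_eq_intros)

definition grad :: "(real ^ 'n \<Rightarrow> real) \<Rightarrow> real ^ 'n \<Rightarrow> real ^ 'n" where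
  "grad f x = (\<chi> i. frechet_derivative f (at x) (axis i 1))"

lemma GDERIV_grad:
  assumes "f differentiable at x"
  shows "GDERIV f x :> grad f x"
proof -
  let ?D = "frechet_derivative f (at x)"
  have D: "(f has_derivative ?D) (at x)"
    using assms by (simp add: frechet_derivative_works)
  then interpret bounded_linear ?D
    by (rule has_derivative_bounded_linear)
  have "?D h = h \<bullet> grad f x" for h
  proof -
    have "?D h = ?D (\<Sum>i\<in>UNIV. h $ i *\<^sub>R axis i 1)"
      by (simp add: basis_expansion flip: scalar_mult_eq_scaleR)
    then show ?thesis
      by (simp add: sum scale grad_def inner_vec_def)
  qed
  then have "?D = (\<lambda>h. h \<bullet> grad f x)" by blast
  with D show ?thesis
    by (simp add: gderiv_def)
qed

definition laplacian :: "(real ^ 'n \<Rightarrow> real) \<Rightarrow> real ^ 'n \<Rightarrow> real" where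
  "laplacian u x = trace (jacobian (grad u) (at x))"

definition C1 :: "(real ^ 'n \<Rightarrow> real) \<Rightarrow> bool" where
  "C1 f \<longleftrightarrow> (\<forall>x. f differentiable at x) \<and> continuous_on UNIV (grad f)"

definition C2 :: "(real ^ 'n \<Rightarrow> real) \<Rightarrow> bool" where
  "C2 f \<longleftrightarrow> (\<forall>x. f differentiable at x) \<and> (\<forall>x. grad f differentiable at x) \<and>
     continuous_on UNIV (\<lambda>x. jacobian (grad f) (at x))"

definition C1_compact :: "(real ^ 'n \<Rightarrow> real) \<Rightarrow> bool" where
  "C1_compact \<xi> \<longleftrightarrow> C1 \<xi> \<and> compact (closure {x. \<xi> x \<noteq> 0})"

definition allen_cahn_solution :: "(real ^ 'n \<Rightarrow> real) \<Rightarrow> bool" where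
  "allen_cahn_solution u \<longleftrightarrow> C2 u \<and> (\<forall>x. - laplacian u x + deriv W (u x) = 0)"

definition stable_on_Rn :: "(real ^ 'n \<Rightarrow> real) \<Rightarrow> bool" where
  "stable_on_Rn u \<longleftrightarrow> (\<forall>\<xi>. C1_compact \<xi> \<longrightarrow>
     (LINT x|lborel. (norm (grad \<xi> x))\<^sup>2 + deriv (deriv W) (u x) * (\<xi> x)\<^sup>2) \<ge> 0)"

definition grad_perp :: "real ^ 'n \<Rightarrow> (real ^ 'n \<Rightarrow> real) \<Rightarrow> real ^ 'n \<Rightarrow> real ^ 'n" where
  "grad_perp e u x = grad u x - (e \<bullet> grad u x) *\<^sub>R e"

text \<open>
  The norm on \<^typ>\<open>real ^ 'n ^ 'n\<close> is the Frobenius (Hilbert-Schmidt) norm, so the first term below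
  is the sum of the squares of all entries of the differential matrix.  The value is the already
  squared quantity; likewise for \<open>K2\<close> and \<open>T2\<close>.
\<close>

definition A2 :: "real ^ 'n \<Rightarrow> (real ^ 'n \<Rightarrow> real) \<Rightarrow> real ^ 'n \<Rightarrow> real" where
  "A2 e u x = (if grad_perp e u x \<noteq> 0
     then ((norm (jacobian (grad_perp e u) (at x)))\<^sup>2
            - (norm (grad (\<lambda>y. norm (grad_perp e u y)) x))\<^sup>2) / (norm (grad u x))\<^sup>2
     else 0)"

text \<open>
  The exponents are integers because \<open>n - 3\<close> is negative for \<open>n \<le> 2\<close>.  For a \<open>C\<^sup>2\<close> function \<open>u\<close> both
  integrands are Borel measurable and bounded on balls, so the Bochner integrals are the genuine ones.
\<close>

definition K2 :: "real \<Rightarrow> (real ^ 'n \<Rightarrow> real) \<Rightarrow> real ^ 'n \<Rightarrow> real" where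
  "K2 r u e = 1 / r powi (int CARD('n) - 3) *
     (LINT x:ball 0 r|lborel. A2 e u x * (norm (grad u x))\<^sup>2)"

definition T2 :: "real \<Rightarrow> (real ^ 'n \<Rightarrow> real) \<Rightarrow> real ^ 'n \<Rightarrow> real" where
  "T2 r u e = 1 / r powi (int CARD('n) - 1) *
     (LINT x:ball 0 r|lborel. (norm (grad u x))\<^sup>2 - (e \<bullet> grad u x)\<^sup>2)"

end

theory Submission
  imports Defs
begin

text \<open>
  Write \<open>V\<close> for the field \<open>grad_perp e u\<close>.  Its components are derivatives of \<open>u\<close> in fixed directions, so
  they solve the linearised equation \<open>-\<Delta>v + W''(u) v = 0\<close>, whose quadratic form is nonnegative by
  stability.  Suppose first that \<open>V\<close> has no zeros and that everything is smooth.  Testing the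
  \<open>i\<close>-th equation with \<open>V\<^sub>i \<eta>\<^sup>2\<close> and adding up gives
  \<open>\<integral> \<bar>DV\<bar>\<^sup>2 \<eta>\<^sup>2 + 2 \<eta> \<bar>V\<bar> \<nabla>\<bar>V\<bar> \<bullet> \<nabla>\<eta> + W''(u) \<bar>V\<bar>\<^sup>2 \<eta>\<^sup>2 = 0\<close>,
  and the test function \<open>\<bar>V\<bar> \<eta>\<close> in the stability inequality gives
  \<open>\<integral> \<bar>\<nabla>\<bar>V\<bar>\<bar>\<^sup>2 \<eta>\<^sup>2 + 2 \<eta> \<bar>V\<bar> \<nabla>\<bar>V\<bar> \<bullet> \<nabla>\<eta> + \<bar>V\<bar>\<^sup>2 \<bar>\<nabla>\<eta>\<bar>\<^sup>2 + W''(u) \<bar>V\<bar>\<^sup>2 \<eta>\<^sup>2 \<ge> 0\<close>.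
  Subtracting, \<open>\<integral> (\<bar>DV\<bar>\<^sup>2 - \<bar>\<nabla>\<bar>V\<bar>\<bar>\<^sup>2) \<eta>\<^sup>2 \<le> \<integral> \<bar>V\<bar>\<^sup>2 \<bar>\<nabla>\<eta>\<bar>\<^sup>2\<close>.  The left integrand is
  \<open>A2 e u\<close> times \<open>\<bar>\<nabla>u\<bar>\<^sup>2 \<eta>\<^sup>2\<close>, and \<open>\<bar>V\<bar>\<^sup>2 = \<bar>\<nabla>u\<bar>\<^sup>2 - (e \<bullet> \<nabla>u)\<^sup>2\<close> is the integrand of \<open>T2\<close>.
  With a cutoff \<open>\<eta>\<close> between the balls of radius \<open>R\<close> and \<open>2 R\<close>, whose gradient is of order \<open>1 / R\<close>, this is
  the claim.

  Two points need care.  The solution is only of class \<open>C\<^sup>2\<close>, so the linearised equation holds weakly; it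
  is obtained in \<open>weak_linearised_equation\<close> by differentiating the weak form of the equation under
  translation, which needs the symmetry of the Hessian (\<open>hessian_symmetric\<close>).  And \<open>\<bar>V\<bar>\<close> need not
  be differentiable at the zeros of \<open>V\<close>; it is replaced by the square root of \<open>\<bar>V\<bar>\<^sup>2 + \<epsilon>\<close>
  (\<open>regularised_inequality\<close>), and dominated convergence recovers the inequality as \<open>\<epsilon>\<close> tends to \<open>0\<close>
  (\<open>stability_inequality\<close>).
\<close>

section \<open>Integrals of compactly supported functions\<close>

lemma continuous_compact_support_cbox:
  fixes f :: "'a::euclidean_space \<Rightarrow> real"
  assumes cont: "continuous_on UNIV f" and supp: "\<And>x. x \<notin> cbox a b \<Longrightarrow> f x = 0"
  shows "integrable lborel f" and "integral (cbox a b) f = integral\<^sup>L lborel f"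
proof -
  have eq: "(\<lambda>x. indicator (cbox a b) x *\<^sub>R f x) = f"
    using supp by (auto simp: indicator_def fun_eq_iff)
  have *: "integrable lborel (\<lambda>x. indicator (cbox a b) x *\<^sub>R f x)"
    by (rule borel_integrable_compact) (auto intro: continuous_on_subset[OF cont])
  then show "integrable lborel f" unfolding eq .
  have "set_integrable lborel (cbox a b) f"
    using * by (simp add: set_integrable_def)
  from set_borel_integral_eq_integral(2)[OF this]
  show "integral (cbox a b) f = integral\<^sup>L lborel f"
    unfolding set_lebesgue_integral_def eq by simp
qed

lemma integrable_continuous_bounded_support:
  fixes f :: "'a::euclidean_space \<Rightarrow> real"
  assumes "continuous_on UNIV f" and "bounded S" and "\<And>x. x \<notin> S \<Longrightarrow> f x = 0"
  shows "integrable lborel f"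
proof -
  obtain a where "S \<subseteq> cbox (- a) a"
    using bounded_subset_cbox_symmetric[OF assms(2)] by blast
  then show ?thesis
    using continuous_compact_support_cbox(1)[OF assms(1)] assms(3) by blast
qed

text \<open>
  A constant function of the parameter \<open>h\<close> has derivative zero, and differentiation under the integral
  sign moves this derivative onto the integrand.  All integrals run over one fixed box containing the
  supports, so joint continuity of \<open>f'\<close> is enough.  Both the divergence theorem and the linearised
  equation below come from this lemma, applied to translations \<open>x + h d\<close>.
\<close>

lemma integral_derivative_eq_0:
  fixes f f' :: "real \<Rightarrow> 'a::euclidean_space \<Rightarrow> real"
  assumes deriv: "\<And>h x. ((\<lambda>h. f h x) has_real_derivative f' h x) (at h)"
    and cont: "\<And>h. continuous_on UNIV (f h)"
    and cont': "continuous_on UNIV (\<lambda>(h, x). f' h x)"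
    and "bounded S" and supp: "\<And>h x. \<bar>h\<bar> \<le> 1 \<Longrightarrow> x \<notin> S \<Longrightarrow> f h x = 0"
    and const: "\<And>h. \<bar>h\<bar> \<le> 1 \<Longrightarrow> integral\<^sup>L lborel (f h) = c"
  shows "integral\<^sup>L lborel (f' 0) = 0"
proof -
  obtain a where a: "S \<subseteq> cbox (- a) a"
    using bounded_subset_cbox_symmetric[OF \<open>bounded S\<close>] by blast
  \<comment> \<open>Off the box, \<open>f\<close> vanishes for all small \<open>h\<close>, hence so does its derivative at \<open>0\<close>.\<close>
  have supp': "f' 0 x = 0" if "x \<notin> cbox (- a) a" for x
  proof (rule DERIV_unique[OF deriv])
    have "((\<lambda>h. 0) has_real_derivative 0) (at (0::real))" by simp
    then show "((\<lambda>h. f h x) has_real_derivative 0) (at 0)"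
      by (rule has_field_derivative_transform_within_open[where S = "{-1<..<1}"])
         (use that a in \<open>auto simp: supp subset_eq\<close>)
  qed
  have cont0: "continuous_on UNIV (f' 0)"
  proof -
    have "continuous_on UNIV (\<lambda>x. (\<lambda>(h, x). f' h x) (0, x))"
      by (rule continuous_on_compose2[OF cont']) (auto intro!: continuous_intros)
    then show ?thesis by simp
  qed
  have "((\<lambda>h. integral (cbox (- a) a) (f h)) has_real_derivative integral (cbox (- a) a) (f' 0))
          (at 0 within {-1..1})"
  proof (rule leibniz_rule_field_derivative)
    show "f h integrable_on cbox (- a) a" for h
      by (intro integrable_continuous continuous_on_subset[OF cont]) auto
    show "continuous_on ({-1..1} \<times> cbox (- a) a) (\<lambda>(x, t). f' x t)"
      by (rule continuous_on_subset[OF cont']) auto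
    show "((\<lambda>x. f x t) has_real_derivative f' x t) (at x within {-1..1})" for x t
      using deriv by (rule has_field_derivative_at_within)
  qed auto
  moreover have "((\<lambda>h. integral (cbox (- a) a) (f h)) has_real_derivative 0) (at 0 within {-1..1})"
  proof (rule has_field_derivative_transform_within[where f = "\<lambda>h. c" and d = 1])
    show "c = integral (cbox (- a) a) (f h)" if "h \<in> {-1..1}" for h
    proof -
      have "\<bar>h\<bar> \<le> 1" using that by auto
      then show ?thesis
        using continuous_compact_support_cbox(2)[OF cont, of "- a" a h] supp a const by fastforce
    qed
  qed auto
  ultimately have "integral (cbox (- a) a) (f' 0) = 0"
    by (rule has_field_derivative_unique) (simp add: at_within_Icc_at)
  then show ?thesis
    using continuous_compact_support_cbox(2)[OF cont0] supp' by simp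
qed

section \<open>Gradients and the symmetry of the Hessian\<close>

lemma GDERIV_along_line:
  fixes x d :: "'a::real_inner"
  assumes "GDERIV f (x + t *\<^sub>R d) :> g"
  shows "((\<lambda>t. f (x + t *\<^sub>R d)) has_real_derivative g \<bullet> d) (at t)"
proof -
  have "((\<lambda>t. f (x + t *\<^sub>R d)) has_derivative (\<lambda>s. (s *\<^sub>R d) \<bullet> g)) (at t)"
    by (rule has_derivative_compose[where g = f and g' = "\<lambda>h. h \<bullet> g" and f = "\<lambda>t. x + t *\<^sub>R d"])
       (use assms in \<open>auto intro!: derivative_eq_intros simp: gderiv_def\<close>)
  then show ?thesis
    by (simp add: has_field_derivative_def inner_commute mult.commute[of "g \<bullet> d"] mult_commute_abs)
qed

lemma GDERIV_inner_matrix: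
  fixes p :: "real ^ 'n \<Rightarrow> real ^ 'm"
  assumes "(p has_derivative (\<lambda>h. A *v h)) (at x)"
  shows "GDERIV (\<lambda>x. p x \<bullet> b) x :> transpose A *v b"
proof -
  have "(\<lambda>h. (A *v h) \<bullet> b) = (\<lambda>h. h \<bullet> (transpose A *v b))"
    by (metis dot_lmul_matrix inner_commute transpose_matrix_vector)
  with has_derivative_inner_left[OF assms, of b] show ?thesis
    by (simp add: gderiv_def)
qed

lemma continuous_on_matrix_vector_mult [continuous_intros]:
  fixes A :: "'a::topological_space \<Rightarrow> real ^ 'n ^ 'm"
  assumes "continuous_on S A" "continuous_on S v"
  shows "continuous_on S (\<lambda>x. A x *v v x)"
  unfolding matrix_vector_mult_def
  by (intro continuous_intros assms)

text \<open>
  Integrating the derivative of \<open>u\<close> in direction \<open>b\<close> along a segment and then differentiating in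
  direction \<open>a\<close> under the integral sign shows that
  \<open>\<integral> (H (x + t b) a) \<bullet> b dt\<close> over \<open>0 \<le> t \<le> r\<close> equals \<open>(p (x + r b) - p x) \<bullet> a\<close>.
  The derivatives of the two sides at \<open>r = 0\<close> are \<open>(H x a) \<bullet> b\<close> and \<open>(H x b) \<bullet> a\<close>.
\<close>

lemma hessian_symmetric:
  fixes u :: "real ^ 'n \<Rightarrow> real"
  assumes grad: "\<And>x. GDERIV u x :> p x"
    and hess: "\<And>x. (p has_derivative (\<lambda>h. H x *v h)) (at x)"
    and cont: "continuous_on UNIV H"
  shows "transpose (H x) = H x"
proof -
  have sym: "(H x *v a) \<bullet> b = (H x *v b) \<bullet> a" for a b
  proof -
    have contp: "continuous_on UNIV p"
      by (meson UNIV_I continuous_at_imp_continuous_on hess has_derivative_continuous)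
    have pd: "((\<lambda>t. p (y + t *\<^sub>R d) \<bullet> c) has_real_derivative (H (y + t *\<^sub>R d) *v d) \<bullet> c) (at t)"
      for y d c t
      using GDERIV_along_line[OF GDERIV_inner_matrix[OF hess, where b = c], where x = y and t = t and d = d]
      by (metis dot_lmul_matrix inner_commute transpose_matrix_vector)
    have contH: "continuous_on S (\<lambda>z. (H (g z) *v d) \<bullet> c)" if "continuous_on S g" for S d c and g :: "'z::topological_space \<Rightarrow> _"
      by (intro continuous_intros continuous_on_compose2[OF cont that]) auto
    have contp': "continuous_on S (\<lambda>z. p (g z) \<bullet> c)" if "continuous_on S g" for S c and g :: "'z::topological_space \<Rightarrow> _"
      by (intro continuous_intros continuous_on_compose2[OF contp that]) auto
    have eq: "integral {0..r} (\<lambda>t. (H (x + t *\<^sub>R b) *v a) \<bullet> b) = (p (x + r *\<^sub>R b) - p x) \<bullet> a"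
      if r: "0 \<le> r" for r
    \<comment> \<open>Both sides are the derivative at \<open>0\<close> of \<open>s \<mapsto> u (x + r b + s a) - u (x + s a)\<close>.\<close>
    proof (rule DERIV_unique)
      have "((\<lambda>s. integral (cbox 0 r) (\<lambda>t. p ((x + t *\<^sub>R b) + s *\<^sub>R a) \<bullet> b)) has_real_derivative
              integral (cbox 0 r) (\<lambda>t. (H ((x + t *\<^sub>R b) + 0 *\<^sub>R a) *v a) \<bullet> b)) (at 0 within UNIV)"
      proof (rule leibniz_rule_field_derivative)
        show "(\<lambda>t. p (x + t *\<^sub>R b + s *\<^sub>R a) \<bullet> b) integrable_on cbox 0 r" for s
          by (intro integrable_continuous contp' continuous_intros)
        show "continuous_on (UNIV \<times> cbox 0 r) (\<lambda>(s, t). (H (x + t *\<^sub>R b + s *\<^sub>R a) *v a) \<bullet> b)"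
          unfolding split_beta by (intro contH continuous_intros)
      qed (use pd in auto)
      moreover have "integral (cbox 0 r) (\<lambda>t. p ((x + t *\<^sub>R b) + s *\<^sub>R a) \<bullet> b)
          = u (x + r *\<^sub>R b + s *\<^sub>R a) - u (x + s *\<^sub>R a)" for s
      proof -
        have "((\<lambda>t. p ((x + s *\<^sub>R a) + t *\<^sub>R b) \<bullet> b) has_integral
            u ((x + s *\<^sub>R a) + r *\<^sub>R b) - u ((x + s *\<^sub>R a) + 0 *\<^sub>R b)) {0..r}"
          by (rule fundamental_theorem_of_calculus[OF r])
             (auto intro: has_field_derivative_at_within GDERIV_along_line[OF grad]
               simp flip: has_real_derivative_iff_has_vector_derivative)
        then show ?thesis by (simp add: integral_unique add_ac)
      qed
      ultimately show "((\<lambda>s. u (x + r *\<^sub>R b + s *\<^sub>R a) - u (x + s *\<^sub>R a)) has_real_derivative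
              integral {0..r} (\<lambda>t. (H (x + t *\<^sub>R b) *v a) \<bullet> b)) (at 0)"
        by simp
      show "((\<lambda>s. u (x + r *\<^sub>R b + s *\<^sub>R a) - u (x + s *\<^sub>R a)) has_real_derivative
              (p (x + r *\<^sub>R b) - p x) \<bullet> a) (at 0)"
        using DERIV_diff[OF GDERIV_along_line[OF grad, of "x + r *\<^sub>R b" a 0] GDERIV_along_line[OF grad, of x a 0]]
        by (simp add: inner_diff_left)
    qed
    have "((\<lambda>r. integral {0..r} (\<lambda>t. (H (x + t *\<^sub>R b) *v a) \<bullet> b)) has_real_derivative
            (H (x + 0 *\<^sub>R b) *v a) \<bullet> b) (at 0 within {0..1})"
      by (rule integral_has_real_derivative) (auto intro!: contH continuous_intros)
    moreover have "((\<lambda>r. integral {0..r} (\<lambda>t. (H (x + t *\<^sub>R b) *v a) \<bullet> b)) has_real_derivative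
            (H (x + 0 *\<^sub>R b) *v b) \<bullet> a) (at 0 within {0..1})"
    proof (rule has_field_derivative_transform_within[where f = "\<lambda>r. p (x + r *\<^sub>R b) \<bullet> a - p x \<bullet> a" and d = 1])
      have "((\<lambda>r. p (x + r *\<^sub>R b) \<bullet> a - p x \<bullet> a) has_real_derivative
               (H (x + 0 *\<^sub>R b) *v b) \<bullet> a - 0) (at 0)"
        by (intro DERIV_diff pd DERIV_const)
      then show "((\<lambda>r. p (x + r *\<^sub>R b) \<bullet> a - p x \<bullet> a) has_real_derivative
               (H (x + 0 *\<^sub>R b) *v b) \<bullet> a) (at 0 within {0..1})"
        by (simp add: has_field_derivative_at_within)
    qed (auto simp: eq inner_diff_left)
    ultimately show ?thesis
      by (auto dest: has_field_derivative_unique simp: trivial_limit_within)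
  qed
  have "(H x *v axis j 1) \<bullet> axis i 1 = H x $ i $ j" for i j
    by (simp add: inner_axis matrix_vector_mul_component)
  then show ?thesis
    using sym by (simp add: vec_eq_iff transpose_def) metis
qed

section \<open>Compactly supported test functions\<close>

text \<open>
  The gradient \<open>\<psi>\<close> is carried along as an argument: the products and translates of test functions used
  below then come with explicit gradients, and no derivative has to be computed from an expression
  involving \<^const>\<open>grad\<close>.
\<close>

definition test_function :: "('a::euclidean_space \<Rightarrow> real) \<Rightarrow> ('a \<Rightarrow> 'a) \<Rightarrow> bool" where
  "test_function \<phi> \<psi> \<longleftrightarrow>
     (\<forall>x. GDERIV \<phi> x :> \<psi> x) \<and> continuous_on UNIV \<psi> \<and> bounded {x. \<phi> x \<noteq> 0}"

lemma continuous_on_GDERIV: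
  assumes "\<And>x. GDERIV f x :> g x"
  shows "continuous_on S f"
  using assms unfolding gderiv_def
  by (meson continuous_at_imp_continuous_on has_derivative_continuous)

lemma GDERIV_unique:
  assumes "GDERIV f x :> g" "GDERIV f x :> g'"
  shows "g = g'"
proof -
  have "(\<lambda>h. h \<bullet> g) = (\<lambda>h. h \<bullet> g')"
    using assms unfolding gderiv_def by (rule has_derivative_unique)
  then show ?thesis
    by (metis inner_commute vector_eq_rdot)
qed

lemma test_functionD:
  assumes "test_function \<phi> \<psi>"
  shows "GDERIV \<phi> x :> \<psi> x" "continuous_on S \<psi>" "continuous_on S \<phi>"
  using assms continuous_on_GDERIV[of \<phi> \<psi>]
  by (auto simp: test_function_def intro: continuous_on_subset)

lemma test_function_support:
  assumes "test_function \<phi> \<psi>"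
  obtains S where "bounded S" "\<And>x. x \<notin> S \<Longrightarrow> \<phi> x = 0" "\<And>x. x \<notin> S \<Longrightarrow> \<psi> x = 0"
proof -
  define S where "S = closure {x. \<phi> x \<noteq> 0}"
  have "bounded S"
    unfolding S_def using assms by (intro bounded_closure) (simp add: test_function_def)
  moreover have 0: "\<phi> x = 0" if "x \<notin> S" for x
    using that closure_subset[of "{x. \<phi> x \<noteq> 0}"] unfolding S_def by blast
  moreover have "\<psi> x = 0" if "x \<notin> S" for x
  proof (rule GDERIV_unique[OF test_functionD(1)[OF assms]])
    have "((\<lambda>y. 0) has_derivative (\<lambda>h. h \<bullet> 0)) (at x)" by simp
    then show "GDERIV \<phi> x :> 0"
      unfolding gderiv_def
    proof (rule has_derivative_transform_within_open)
      show "open (- S)" by (simp add: S_def open_Compl)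
    qed (use that 0 in auto)
  qed
  ultimately show thesis by (rule that)
qed

lemma test_function_translate:
  assumes "test_function \<phi> \<psi>"
  shows "test_function (\<lambda>x. \<phi> (x + c)) (\<lambda>x. \<psi> (x + c))"
  unfolding test_function_def
proof (intro conjI allI)
  show "GDERIV (\<lambda>x. \<phi> (x + c)) x :> \<psi> (x + c)" for x
    using test_functionD(1)[OF assms, of "x + c"] unfolding gderiv_def
    by (intro has_derivative_compose[where g = \<phi> and f = "\<lambda>x. x + c"]) (auto intro!: derivative_eq_intros)
  show "continuous_on UNIV (\<lambda>x. \<psi> (x + c))"
    by (intro continuous_on_compose2[OF test_functionD(2)[OF assms, of UNIV]] continuous_intros) auto
  have "{x. \<phi> (x + c) \<noteq> 0} = (\<lambda>y. - c + y) ` {x. \<phi> x \<noteq> 0}"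
  proof (intro equalityI subsetI)
    fix x assume "x \<in> {x. \<phi> (x + c) \<noteq> 0}"
    then show "x \<in> (\<lambda>y. - c + y) ` {x. \<phi> x \<noteq> 0}"
      by (intro image_eqI[where x = "x + c"]) auto
  qed auto
  then show "bounded {x. \<phi> (x + c) \<noteq> 0}"
    using assms bounded_translation[of "{x. \<phi> x \<noteq> 0}" "- c"] unfolding test_function_def by metis
qed

lemma test_function_mult:
  assumes "test_function \<phi> \<psi>" and "\<And>x. GDERIV w x :> q x" and "continuous_on UNIV q"
  shows "test_function (\<lambda>x. w x * \<phi> x) (\<lambda>x. w x *\<^sub>R \<psi> x + \<phi> x *\<^sub>R q x)"
  unfolding test_function_def
proof (intro conjI allI)
  show "GDERIV (\<lambda>x. w x * \<phi> x) x :> w x *\<^sub>R \<psi> x + \<phi> x *\<^sub>R q x" for x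
    by (rule GDERIV_mult[OF assms(2) test_functionD(1)[OF assms(1)]])
  show "continuous_on UNIV (\<lambda>x. w x *\<^sub>R \<psi> x + \<phi> x *\<^sub>R q x)"
    by (intro continuous_intros assms test_functionD[OF assms(1)] continuous_on_GDERIV[of w q])
  show "bounded {x. w x * \<phi> x \<noteq> 0}"
    using assms(1) by (auto simp: test_function_def elim: bounded_subset)
qed

lemma lborel_integral_translate:
  fixes f :: "'a::euclidean_space \<Rightarrow> real"
  assumes "continuous_on UNIV f"
  shows "(LINT x|lborel. f (x + c)) = (LINT x|lborel. f x)"
proof -
  have "f \<in> borel_measurable borel"
    using assms by (rule borel_measurable_continuous_onI)
  then have "integral\<^sup>L (distr lborel borel ((+) c)) f = (LINT x|lborel. f (c + x))"
    by (intro integral_distr) auto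
  then show ?thesis
    by (simp add: lborel_distr_plus add.commute)
qed

text \<open>
  The divergence theorem without boundary term: the integral of a function does not change under
  translation of the function in direction \<open>d\<close>.
\<close>

lemma integral_test_function_gradient:
  assumes "test_function \<phi> \<psi>"
  shows "(LINT x|lborel. \<psi> x \<bullet> d) = 0"
proof -
  obtain S where S: "bounded S" "\<And>x. x \<notin> S \<Longrightarrow> \<phi> x = 0"
    using test_function_support[OF assms] by metis
  obtain B where B: "\<And>x. x \<in> S \<Longrightarrow> norm x \<le> B"
    using S(1) by (auto simp: bounded_iff)
  have "(LINT x|lborel. \<psi> (x + 0 *\<^sub>R d) \<bullet> d) = 0"
  proof (rule integral_derivative_eq_0[where f = "\<lambda>h x. \<phi> (x + h *\<^sub>R d)" and S = "cball 0 (B + norm d)" and f' = "\<lambda>h x. \<psi> (x + h *\<^sub>R d) \<bullet> d"])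
    show "((\<lambda>h. \<phi> (x + h *\<^sub>R d)) has_real_derivative \<psi> (x + h *\<^sub>R d) \<bullet> d) (at h)" for h x
      by (rule GDERIV_along_line[OF test_functionD(1)[OF assms]])
    show "continuous_on UNIV (\<lambda>x. \<phi> (x + h *\<^sub>R d))" for h
      by (intro continuous_on_compose2[OF test_functionD(3)[OF assms, of UNIV]] continuous_intros) auto
    show "continuous_on UNIV (\<lambda>(h, x). \<psi> (x + h *\<^sub>R d) \<bullet> d)"
      unfolding split_beta
      by (intro continuous_intros continuous_on_compose2[OF test_functionD(2)[OF assms, of UNIV]]) auto
    show "\<phi> (x + h *\<^sub>R d) = 0" if "\<bar>h\<bar> \<le> 1" "x \<notin> cball 0 (B + norm d)" for h x
    proof (rule S(2), rule notI)
      assume "x + h *\<^sub>R d \<in> S"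
      then have "norm (x + h *\<^sub>R d) \<le> B" by (rule B)
      moreover have "norm x \<le> norm (x + h *\<^sub>R d) + norm (h *\<^sub>R d)"
        by (metis add_diff_cancel_right' norm_triangle_ineq4)
      moreover have "norm (h *\<^sub>R d) \<le> norm d"
        using that(1) by (simp add: mult_left_le_one_le)
      ultimately show False using that(2) by auto
    qed
    show "(LINT x|lborel. \<phi> (x + h *\<^sub>R d)) = (LINT x|lborel. \<phi> x)" for h
      by (rule lborel_integral_translate[OF test_functionD(3)[OF assms]])
  qed auto
  then show ?thesis by simp
qed

section \<open>The weak and the linearised equation\<close>

text \<open>
  A solution of \<open>\<Delta>u = f(u)\<close> of class \<open>C\<^sup>2\<close> with gradient \<open>p\<close> and Hessian \<open>H\<close>, where \<open>f\<close> is of class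
  \<open>C\<^sup>1\<close>.
\<close>

locale semilinear_solution =
  fixes u :: "real ^ 'n \<Rightarrow> real" and p :: "real ^ 'n \<Rightarrow> real ^ 'n" and H :: "real ^ 'n \<Rightarrow> real ^ 'n ^ 'n"
    and f f' :: "real \<Rightarrow> real"
  assumes grad: "GDERIV u x :> p x"
    and hess: "(p has_derivative (\<lambda>h. H x *v h)) (at x)"
    and cont_H: "continuous_on UNIV H"
    and deriv_f: "(f has_real_derivative f' s) (at s)"
    and cont_f': "continuous_on UNIV f'"
    and equation: "trace (H x) = f (u x)"
begin

lemma cont_p: "continuous_on UNIV p"
  by (meson continuous_at_imp_continuous_on hess has_derivative_continuous)

lemma cont_u: "continuous_on UNIV u"
  by (rule continuous_on_GDERIV[OF grad])

lemma cont_f: "continuous_on UNIV f"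
  by (meson DERIV_isCont continuous_at_imp_continuous_on deriv_f)

lemma sym_H: "transpose (H x) = H x"
  by (rule hessian_symmetric[OF grad hess cont_H])

lemma sym_H_inner: "(H x *v a) \<bullet> b = (H x *v b) \<bullet> a"
  by (metis dot_lmul_matrix inner_commute sym_H transpose_matrix_vector)

lemma grad_p: "GDERIV (\<lambda>x. p x \<bullet> d) x :> H x *v d"
  using GDERIV_inner_matrix[OF hess, of d x] by (simp add: sym_H)

lemma weak_equation:
  assumes "test_function \<phi> \<psi>"
  shows "(LINT x|lborel. p x \<bullet> \<psi> x + f (u x) * \<phi> x) = 0"
proof -
  note tf = test_functionD[OF assms]
  obtain S where S: "bounded S" "\<And>x. x \<notin> S \<Longrightarrow> \<phi> x = 0" "\<And>x. x \<notin> S \<Longrightarrow> \<psi> x = 0"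
    using test_function_support[OF assms] by metis
  \<comment> \<open>\<open>F j\<close> is the \<open>j\<close>-th partial derivative of \<open>\<phi> (p \<bullet> e\<^sub>j)\<close>; the sum over \<open>j\<close> is the divergence of \<open>\<phi> p\<close>.\<close>
  define F where "F = (\<lambda>j x. ((p x \<bullet> axis j 1) *\<^sub>R \<psi> x + \<phi> x *\<^sub>R (H x *v axis j 1)) \<bullet> axis j 1)"
  have F0: "(LINT x|lborel. F j x) = 0" for j
    unfolding F_def
    by (rule integral_test_function_gradient[OF test_function_mult[OF assms grad_p]])
       (intro continuous_intros cont_H)
  have int: "integrable lborel (F j)" for j
    unfolding F_def
    by (rule integrable_continuous_bounded_support[OF _ S(1)])
       (auto intro!: continuous_intros cont_p cont_H tf simp: S)
  have "(\<Sum>j\<in>UNIV. F j x) = p x \<bullet> \<psi> x + f (u x) * \<phi> x" for x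
  proof -
    have "F j x = p x $ j * \<psi> x $ j + \<phi> x * H x $ j $ j" for j
      by (simp add: F_def inner_axis inner_add_left matrix_vector_mul_component)
    then show ?thesis
      by (simp add: sum.distrib inner_vec_def equation[symmetric] trace_def sum_distrib_left mult.commute)
  qed
  then have "(LINT x|lborel. p x \<bullet> \<psi> x + f (u x) * \<phi> x) = (LINT x|lborel. (\<Sum>j\<in>UNIV. F j x))"
    by simp
  also have "\<dots> = 0"
    using int F0 by (subst Bochner_Integration.integral_sum) auto
  finally show ?thesis .
qed

text \<open>
  The derivative \<open>p \<bullet> d\<close> of \<open>u\<close> satisfies the linearised equation, but only weakly, since \<open>u\<close> is merely of
  class \<open>C\<^sup>2\<close>.  Third derivatives are avoided by differentiating the weak equation: testing it with
  the translates of \<open>\<phi>\<close> and moving the translation onto \<open>u\<close> gives an integral that vanishes for all \<open>h\<close>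
  and whose integrand is differentiable in \<open>h\<close>.
\<close>

lemma weak_linearised_equation:
  assumes "test_function \<phi> \<psi>"
  shows "(LINT x|lborel. (H x *v d) \<bullet> \<psi> x + f' (u x) * (p x \<bullet> d) * \<phi> x) = 0"
proof -
  note tf = test_functionD[OF assms]
  obtain S where S: "bounded S" "\<And>x. x \<notin> S \<Longrightarrow> \<phi> x = 0" "\<And>x. x \<notin> S \<Longrightarrow> \<psi> x = 0"
    using test_function_support[OF assms] by metis
  note comp = continuous_on_compose2[OF cont_p] continuous_on_compose2[OF cont_H]
    continuous_on_compose2[OF cont_u] continuous_on_compose2[OF cont_f] continuous_on_compose2[OF cont_f']
    continuous_on_compose2[OF tf(2)[of UNIV]] continuous_on_compose2[OF tf(3)[of UNIV]]
  let ?f = "\<lambda>h x. p (x + h *\<^sub>R d) \<bullet> \<psi> x + f (u (x + h *\<^sub>R d)) * \<phi> x"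
  let ?f' = "\<lambda>h x. (H (x + h *\<^sub>R d) *v d) \<bullet> \<psi> x
                    + f' (u (x + h *\<^sub>R d)) * (p (x + h *\<^sub>R d) \<bullet> d) * \<phi> x"
  have "(LINT x|lborel. ?f' 0 x) = 0"
  proof (rule integral_derivative_eq_0[where f = ?f and f' = ?f' and S = S])
    fix h x
    have "((\<lambda>h. p (x + h *\<^sub>R d) \<bullet> \<psi> x) has_real_derivative (H (x + h *\<^sub>R d) *v \<psi> x) \<bullet> d) (at h)"
      by (rule GDERIV_along_line[OF grad_p])
    moreover have "((\<lambda>h. f (u (x + h *\<^sub>R d))) has_real_derivative
        f' (u (x + h *\<^sub>R d)) * (p (x + h *\<^sub>R d) \<bullet> d)) (at h)"
      by (rule DERIV_chain2[OF deriv_f GDERIV_along_line[OF grad]])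
    ultimately show "((\<lambda>h. ?f h x) has_real_derivative ?f' h x) (at h)"
      by (auto intro!: derivative_eq_intros simp: sym_H_inner)
  next
    fix h
    show "continuous_on UNIV (?f h)"
      by (intro continuous_intros comp subset_UNIV)
    have "(LINT x|lborel. ?f h x) = (LINT x|lborel. ?f h (x + (- h *\<^sub>R d)))"
      by (rule lborel_integral_translate[symmetric]) (intro continuous_intros comp subset_UNIV)
    also have "\<dots> = 0"
      using weak_equation[OF test_function_translate[OF assms, of "- h *\<^sub>R d"]] by simp
    finally show "(LINT x|lborel. ?f h x) = 0" .
  next
    show "continuous_on UNIV (\<lambda>(h, x). ?f' h x)"
      unfolding split_beta by (intro continuous_intros comp subset_UNIV)
  qed (auto simp: S)
  then show ?thesis by simp
qed

end

section \<open>The length of a vector field\<close>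

lemma norm_matrix_vector_mult_le:
  fixes A :: "real ^ 'n ^ 'm"
  shows "norm (A *v x) \<le> norm A * norm x"
proof -
  have "(norm (A *v x))\<^sup>2 = (\<Sum>i\<in>UNIV. (A $ i \<bullet> x)\<^sup>2)"
    unfolding power2_norm_eq_inner inner_vec_def[of "A *v x"]
    by (simp add: matrix_vector_mul_component power2_eq_square)
  also have "\<dots> \<le> (\<Sum>i\<in>UNIV. (A $ i \<bullet> A $ i) * (x \<bullet> x))"
    by (intro sum_mono Cauchy_Schwarz_ineq)
  also have "\<dots> = (norm A * norm x)\<^sup>2"
    by (simp add: power_mult_distrib power2_norm_eq_inner inner_vec_def[of A] sum_distrib_right)
  finally show ?thesis
    by (rule power2_le_imp_le) simp
qed

text \<open>
  In terms of a vector field \<open>v\<close> with differential \<open>A\<close>, this bounds the gradient of its length by the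
  Frobenius norm of its differential: \<open>A\<^sup>T v\<close> is \<open>\<bar>v\<bar>\<close> times the gradient of \<open>\<bar>v\<bar>\<close>.  It makes the
  numerator of \<open>A'\<^sup>2\<close> nonnegative.
\<close>

lemma norm_transpose_mult_le:
  fixes A :: "real ^ 'n ^ 'm"
  shows "(norm (transpose A *v v))\<^sup>2 \<le> (norm v)\<^sup>2 * (norm A)\<^sup>2"
proof -
  let ?g = "transpose A *v v"
  have "(norm ?g)\<^sup>2 = v \<bullet> (A *v ?g)"
    by (metis dot_lmul_matrix power2_norm_eq_inner transpose_matrix_vector)
  also have "\<dots> \<le> norm v * (norm A * norm ?g)"
    by (meson mult_left_mono norm_cauchy_schwarz norm_ge_zero norm_matrix_vector_mult_le order_trans)
  finally have "norm ?g \<le> norm v * norm A"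
    by (cases "norm ?g = 0") (auto simp: power2_eq_square mult.assoc[symmetric])
  then show ?thesis
    by (metis norm_ge_zero power_mono power_mult_distrib)
qed

lemma continuous_on_transpose [continuous_intros]:
  fixes A :: "'a::topological_space \<Rightarrow> real ^ 'n ^ 'm"
  assumes "continuous_on S A"
  shows "continuous_on S (\<lambda>x. transpose (A x))"
  unfolding transpose_def by (intro continuous_intros assms)

lemma GDERIV_norm_squared:
  fixes V :: "real ^ 'n \<Rightarrow> real ^ 'm"
  assumes "(V has_derivative (\<lambda>h. J *v h)) (at x)"
  shows "GDERIV (\<lambda>x. (norm (V x))\<^sup>2) x :> 2 *\<^sub>R (transpose J *v V x)"
proof -
  have "(\<lambda>h. V x \<bullet> (J *v h) + (J *v h) \<bullet> V x) = (\<lambda>h. h \<bullet> (2 *\<^sub>R (transpose J *v V x)))"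
    by (metis (no_types, opaque_lifting) dot_lmul_matrix inner_commute inner_scaleR_right mult_2 transpose_matrix_vector)
  with has_derivative_inner[OF assms assms] show ?thesis
    by (simp add: gderiv_def power2_norm_eq_inner)
qed

lemma GDERIV_norm_comp:
  fixes V :: "real ^ 'n \<Rightarrow> real ^ 'm"
  assumes "(V has_derivative (\<lambda>h. J *v h)) (at x)" and "V x \<noteq> 0"
  shows "GDERIV (\<lambda>x. norm (V x)) x :> (1 / norm (V x)) *\<^sub>R (transpose J *v V x)"
proof -
  have "(sqrt has_real_derivative 1 / (2 * norm (V x))) (at ((norm (V x))\<^sup>2))"
    using assms(2) DERIV_real_sqrt[of "(norm (V x))\<^sup>2"] by (simp add: field_simps)
  from GDERIV_DERIV_compose[OF GDERIV_norm_squared[OF assms(1)] this]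
  show ?thesis by simp
qed

section \<open>The stability inequality for the length of a vector field\<close>

text \<open>
  A \<open>C\<^sup>1\<close> vector field \<open>V\<close> with differential \<open>J\<close>, each component of which solves \<open>-\<Delta>v + c v = 0\<close>
  weakly, where the quadratic form of the operator \<open>-\<Delta> + c\<close> is nonnegative.
\<close>

locale linearised_system =
  fixes V :: "real ^ 'n \<Rightarrow> real ^ 'm" and J :: "real ^ 'n \<Rightarrow> real ^ 'n ^ 'm" and c :: "real ^ 'n \<Rightarrow> real"
  assumes deriv_V: "(V has_derivative (\<lambda>h. J x *v h)) (at x)"
    and cont_J: "continuous_on UNIV J"
    and cont_c: "continuous_on UNIV c"
    and weak: "test_function \<phi> \<psi> \<Longrightarrow> (LINT x|lborel. J x $ i \<bullet> \<psi> x + c x * V x $ i * \<phi> x) = 0"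
    and stable: "test_function \<xi> \<zeta> \<Longrightarrow> (LINT x|lborel. (norm (\<zeta> x))\<^sup>2 + c x * (\<xi> x)\<^sup>2) \<ge> 0"
begin

text \<open>
  Half the gradient of \<open>\<bar>V\<bar>\<^sup>2\<close>.  Unlike the gradient of \<open>\<bar>V\<bar>\<close>, which is \<open>half_grad / \<bar>V\<bar>\<close>, it is
  continuous across the zeros of \<open>V\<close>.
\<close>

definition half_grad :: "real ^ 'n \<Rightarrow> real ^ 'n" where "half_grad x = transpose (J x) *v V x"

lemma cont_V: "continuous_on UNIV V"
  by (meson continuous_at_imp_continuous_on deriv_V has_derivative_continuous)

lemma cont_half_grad: "continuous_on UNIV half_grad"
  unfolding half_grad_def [abs_def] by (intro continuous_intros cont_J cont_V)

lemma half_grad_eq_sum: "half_grad x = (\<Sum>i\<in>UNIV. V x $ i *\<^sub>R J x $ i)"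
  by (simp add: half_grad_def vec_eq_iff matrix_vector_mult_def transpose_def mult.commute)

lemma norm_half_grad_le: "(norm (half_grad x))\<^sup>2 \<le> (norm (V x))\<^sup>2 * (norm (J x))\<^sup>2"
  unfolding half_grad_def by (rule norm_transpose_mult_le)

text \<open>
  The \<open>i\<close>-th equation is tested with \<open>V\<^sub>i \<eta>\<^sup>2\<close>, and the results are added.
\<close>

lemma tested_system:
  assumes "test_function \<eta> \<nu>"
  shows "(LINT x|lborel. (norm (J x))\<^sup>2 * (\<eta> x)\<^sup>2 + 2 * \<eta> x * (half_grad x \<bullet> \<nu> x)
            + c x * (norm (V x))\<^sup>2 * (\<eta> x)\<^sup>2) = 0"
proof -
  note tf = test_functionD[OF assms]
  obtain S where S: "bounded S" "\<And>x. x \<notin> S \<Longrightarrow> \<eta> x = 0" "\<And>x. x \<notin> S \<Longrightarrow> \<nu> x = 0"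
    using test_function_support[OF assms] by metis
  define \<psi> where "\<psi> = (\<lambda>i x. V x $ i *\<^sub>R (\<eta> x *\<^sub>R \<nu> x + \<eta> x *\<^sub>R \<nu> x) + (\<eta> x * \<eta> x) *\<^sub>R J x $ i)"
  have gV: "GDERIV (\<lambda>x. V x $ i) x :> J x $ i" for i x
    unfolding gderiv_def
    using bounded_linear.has_derivative[OF bounded_linear_vec_nth deriv_V, of i x]
    by (simp add: matrix_vector_mul_component inner_commute)
  have test: "test_function (\<lambda>x. V x $ i * (\<eta> x * \<eta> x)) (\<psi> i)" for i
    unfolding \<psi>_def
    by (rule test_function_mult[OF test_function_mult[OF assms tf(1) tf(2)] gV])
       (intro continuous_intros cont_J)
  let ?F = "\<lambda>i x. J x $ i \<bullet> \<psi> i x + c x * V x $ i * (V x $ i * (\<eta> x * \<eta> x))"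
  have int: "integrable lborel (?F i)" for i
    unfolding \<psi>_def
    by (rule integrable_continuous_bounded_support[OF _ S(1)])
       (intro continuous_intros cont_J cont_V cont_c tf, simp add: S)
  have "(\<Sum>i\<in>UNIV. ?F i x) = (norm (J x))\<^sup>2 * (\<eta> x)\<^sup>2 + 2 * \<eta> x * (half_grad x \<bullet> \<nu> x)
            + c x * (norm (V x))\<^sup>2 * (\<eta> x)\<^sup>2" for x
  proof -
    have "?F i x = (J x $ i \<bullet> J x $ i) * (\<eta> x)\<^sup>2 + 2 * \<eta> x * (V x $ i * (J x $ i \<bullet> \<nu> x))
             + c x * (V x $ i * V x $ i) * (\<eta> x)\<^sup>2" for i
      unfolding \<psi>_def inner_add_right inner_scaleR_right
      by (simp add: power2_eq_square algebra_simps)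
    moreover have "(norm (J x))\<^sup>2 = (\<Sum>i\<in>UNIV. J x $ i \<bullet> J x $ i)"
      and "(norm (V x))\<^sup>2 = (\<Sum>i\<in>UNIV. V x $ i * V x $ i)"
      by (simp_all add: power2_norm_eq_inner inner_vec_def[of "J x"] inner_vec_def[of "V x"])
    ultimately show ?thesis
      by (simp add: half_grad_eq_sum inner_sum_left sum.distrib sum_distrib_left sum_distrib_right)
  qed
  then have "(LINT x|lborel. (norm (J x))\<^sup>2 * (\<eta> x)\<^sup>2 + 2 * \<eta> x * (half_grad x \<bullet> \<nu> x)
            + c x * (norm (V x))\<^sup>2 * (\<eta> x)\<^sup>2) = (LINT x|lborel. (\<Sum>i\<in>UNIV. ?F i x))"
    by simp
  also have "\<dots> = 0"
    using weak[OF test] int by (subst Bochner_Integration.integral_sum) auto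
  finally show ?thesis .
qed

text \<open>
  The test function one would like to use, \<open>\<bar>V\<bar> \<eta>\<close>, need not be differentiable at the zeros of \<open>V\<close>.  It is
  replaced by \<open>\<eta>\<close> times the square root of \<open>\<bar>V\<bar>\<^sup>2 + \<epsilon>\<close>, whose gradient is \<open>half_grad\<close> divided by that
  root.
\<close>

lemma regularised_stability:
  assumes "test_function \<eta> \<nu>" and eps: "\<epsilon> > 0"
  shows "(LINT x|lborel. (\<eta> x)\<^sup>2 * (norm (half_grad x))\<^sup>2 / ((norm (V x))\<^sup>2 + \<epsilon>) + 2 * \<eta> x * (half_grad x \<bullet> \<nu> x)
            + ((norm (V x))\<^sup>2 + \<epsilon>) * (norm (\<nu> x))\<^sup>2 + c x * ((norm (V x))\<^sup>2 + \<epsilon>) * (\<eta> x)\<^sup>2) \<ge> 0"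
proof -
  note tf = test_functionD[OF assms(1)]
  define s where "s = (\<lambda>x. sqrt ((norm (V x))\<^sup>2 + \<epsilon>))"
  have pos: "(norm (V x))\<^sup>2 + \<epsilon> > 0" for x
    using eps by (simp add: add_nonneg_pos)
  have s_pos: "s x > 0" for x
    using pos by (simp add: s_def)
  have s2: "(s x)\<^sup>2 = (norm (V x))\<^sup>2 + \<epsilon>" for x
    using pos[of x] by (simp add: s_def)
  have grad_s: "GDERIV s x :> (1 / s x) *\<^sub>R half_grad x" for x
  proof -
    have "GDERIV (\<lambda>x. (norm (V x))\<^sup>2 + \<epsilon>) x :> 2 *\<^sub>R half_grad x + 0"
      unfolding half_grad_def by (intro GDERIV_add GDERIV_norm_squared[OF deriv_V] GDERIV_const)
    moreover have "(sqrt has_real_derivative inverse (s x) / 2) (at ((norm (V x))\<^sup>2 + \<epsilon>))"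
      unfolding s_def by (rule DERIV_real_sqrt[OF pos])
    ultimately show ?thesis
      using GDERIV_DERIV_compose[of "\<lambda>x. (norm (V x))\<^sup>2 + \<epsilon>" x "2 *\<^sub>R half_grad x + 0" sqrt "inverse (s x) / 2"]
      by (simp add: s_def inverse_eq_divide)
  qed
  have cont_s: "continuous_on UNIV s"
    by (rule continuous_on_GDERIV[OF grad_s])
  have "test_function (\<lambda>x. s x * \<eta> x) (\<lambda>x. s x *\<^sub>R \<nu> x + \<eta> x *\<^sub>R (1 / s x) *\<^sub>R half_grad x)"
    by (rule test_function_mult[OF assms(1) grad_s])
       (use s_pos in \<open>auto intro!: continuous_intros cont_s cont_half_grad simp: less_imp_neq[symmetric]\<close>)
  note stable[OF this]
  also have "(LINT x|lborel. (norm (s x *\<^sub>R \<nu> x + \<eta> x *\<^sub>R (1 / s x) *\<^sub>R half_grad x))\<^sup>2 + c x * (s x * \<eta> x)\<^sup>2)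
    = (LINT x|lborel. (\<eta> x)\<^sup>2 * (norm (half_grad x))\<^sup>2 / ((norm (V x))\<^sup>2 + \<epsilon>) + 2 * \<eta> x * (half_grad x \<bullet> \<nu> x)
            + ((norm (V x))\<^sup>2 + \<epsilon>) * (norm (\<nu> x))\<^sup>2 + c x * ((norm (V x))\<^sup>2 + \<epsilon>) * (\<eta> x)\<^sup>2)"
  proof (rule Bochner_Integration.integral_cong[OF refl])
    fix x
    have "(norm (s x *\<^sub>R \<nu> x + \<eta> x *\<^sub>R (1 / s x) *\<^sub>R half_grad x))\<^sup>2
       = (s x)\<^sup>2 * (norm (\<nu> x))\<^sup>2 + 2 * \<eta> x * (half_grad x \<bullet> \<nu> x) + (\<eta> x)\<^sup>2 * (norm (half_grad x))\<^sup>2 / (s x)\<^sup>2"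
    proof -
      have "(norm (a + b))\<^sup>2 = (norm a)\<^sup>2 + 2 * (a \<bullet> b) + (norm b)\<^sup>2" for a b :: "real ^ 'n"
        by (simp add: power2_norm_eq_inner inner_add_left inner_add_right inner_commute)
      moreover have "(s x *\<^sub>R \<nu> x) \<bullet> (\<eta> x *\<^sub>R (1 / s x) *\<^sub>R half_grad x) = \<eta> x * (half_grad x \<bullet> \<nu> x)"
        using s_pos[of x] by (simp add: inner_commute)
      ultimately show ?thesis
        by (simp add: power_mult_distrib power_divide)
    qed
    then show "(norm (s x *\<^sub>R \<nu> x + \<eta> x *\<^sub>R (1 / s x) *\<^sub>R half_grad x))\<^sup>2 + c x * (s x * \<eta> x)\<^sup>2
      = (\<eta> x)\<^sup>2 * (norm (half_grad x))\<^sup>2 / ((norm (V x))\<^sup>2 + \<epsilon>) + 2 * \<eta> x * (half_grad x \<bullet> \<nu> x)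
            + ((norm (V x))\<^sup>2 + \<epsilon>) * (norm (\<nu> x))\<^sup>2 + c x * ((norm (V x))\<^sup>2 + \<epsilon>) * (\<eta> x)\<^sup>2"
      by (simp add: s2 power_mult_distrib)
  qed
  finally show ?thesis .
qed

text \<open>
  In the difference of the two preceding integrals the mixed terms \<open>2 \<eta> half_grad \<bullet> \<nu>\<close> cancel, and of
  the terms with \<open>c\<close> only \<open>\<epsilon> c \<eta>\<^sup>2\<close> survives.
\<close>

lemma regularised_inequality:
  assumes "test_function \<eta> \<nu>" and eps: "\<epsilon> > 0"
  shows "(LINT x|lborel. ((norm (J x))\<^sup>2 - (norm (half_grad x))\<^sup>2 / ((norm (V x))\<^sup>2 + \<epsilon>)) * (\<eta> x)\<^sup>2)
    \<le> (LINT x|lborel. (norm (V x))\<^sup>2 * (norm (\<nu> x))\<^sup>2)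
        + \<epsilon> * (LINT x|lborel. (norm (\<nu> x))\<^sup>2 + c x * (\<eta> x)\<^sup>2)"
proof -
  note tf = test_functionD[OF assms(1)]
  obtain S where S: "bounded S" "\<And>x. x \<notin> S \<Longrightarrow> \<eta> x = 0" "\<And>x. x \<notin> S \<Longrightarrow> \<nu> x = 0"
    using test_function_support[OF assms(1)] by metis
  have pos: "(norm (V x))\<^sup>2 + \<epsilon> \<noteq> 0" for x
    using eps by (smt (verit) zero_le_power2)
  let ?A = "\<lambda>x. (\<eta> x)\<^sup>2 * (norm (half_grad x))\<^sup>2 / ((norm (V x))\<^sup>2 + \<epsilon>) + 2 * \<eta> x * (half_grad x \<bullet> \<nu> x)
            + ((norm (V x))\<^sup>2 + \<epsilon>) * (norm (\<nu> x))\<^sup>2 + c x * ((norm (V x))\<^sup>2 + \<epsilon>) * (\<eta> x)\<^sup>2"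
  let ?B = "\<lambda>x. (norm (J x))\<^sup>2 * (\<eta> x)\<^sup>2 + 2 * \<eta> x * (half_grad x \<bullet> \<nu> x) + c x * (norm (V x))\<^sup>2 * (\<eta> x)\<^sup>2"
  let ?D = "\<lambda>x. ((norm (J x))\<^sup>2 - (norm (half_grad x))\<^sup>2 / ((norm (V x))\<^sup>2 + \<epsilon>)) * (\<eta> x)\<^sup>2"
  let ?E = "\<lambda>x. (norm (V x))\<^sup>2 * (norm (\<nu> x))\<^sup>2"
  let ?G = "\<lambda>x. (norm (\<nu> x))\<^sup>2 + c x * (\<eta> x)\<^sup>2"
  note [continuous_intros] = cont_J cont_V cont_c cont_half_grad tf
  have int: "integrable lborel ?A" "integrable lborel ?B" "integrable lborel ?D"
      "integrable lborel ?E" "integrable lborel ?G"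
    by (rule integrable_continuous_bounded_support[OF _ S(1)],
        use pos in \<open>auto intro!: continuous_intros simp: S\<close>)+
  have "(LINT x|lborel. ?A x) = (LINT x|lborel. ?B x - ?D x + ?E x + \<epsilon> * ?G x)"
    by (rule Bochner_Integration.integral_cong) (auto simp: algebra_simps)
  also have "\<dots> = (LINT x|lborel. ?B x) - (LINT x|lborel. ?D x) + (LINT x|lborel. ?E x) + \<epsilon> * (LINT x|lborel. ?G x)"
    using int by simp
  finally show ?thesis
    using regularised_stability[OF assms] tested_system[OF assms(1)] by simp
qed

text \<open>
  Letting \<open>\<epsilon>\<close> tend to \<open>0\<close>, with dominating function \<open>\<bar>J\<bar>\<^sup>2 \<eta>\<^sup>2\<close>.  Where \<open>V = 0\<close> also \<open>half_grad = 0\<close>,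
  and both the regularised quotient and the quotient \<open>0 / 0 = 0\<close> vanish, so the convergence holds
  at every point.
\<close>

lemma stability_inequality:
  assumes "test_function \<eta> \<nu>"
  defines "D \<equiv> \<lambda>x. ((norm (J x))\<^sup>2 - (norm (half_grad x))\<^sup>2 / (norm (V x))\<^sup>2) * (\<eta> x)\<^sup>2"
  shows "integrable lborel D"
    and "(LINT x|lborel. D x) \<le> (LINT x|lborel. (norm (V x))\<^sup>2 * (norm (\<nu> x))\<^sup>2)"
proof -
  note tf = test_functionD[OF assms(1)]
  obtain S where S: "bounded S" "\<And>x. x \<notin> S \<Longrightarrow> \<eta> x = 0" "\<And>x. x \<notin> S \<Longrightarrow> \<nu> x = 0"
    using test_function_support[OF assms(1)] by metis
  note [continuous_intros] = cont_J cont_V cont_c cont_half_grad tf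
  define \<epsilon> where "\<epsilon> = (\<lambda>n. inverse (real (Suc n)))"
  have eps: "\<epsilon> n > 0" for n by (simp add: \<epsilon>_def)
  have eps0: "\<epsilon> \<longlonglongrightarrow> 0"
    unfolding \<epsilon>_def by (rule LIMSEQ_inverse_real_of_nat)
  define Dn where "Dn = (\<lambda>n x. ((norm (J x))\<^sup>2 - (norm (half_grad x))\<^sup>2 / ((norm (V x))\<^sup>2 + \<epsilon> n)) * (\<eta> x)\<^sup>2)"
  have pos: "(norm (V x))\<^sup>2 + \<epsilon> n \<noteq> 0" for x n
    using eps[of n] by (smt (verit) zero_le_power2)
  have cont: "continuous_on UNIV (Dn n)" for n
    unfolding Dn_def using pos by (auto intro!: continuous_intros)
  have lim: "(\<lambda>n. Dn n x) \<longlonglongrightarrow> D x" for x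
  proof (cases "V x = 0")
    case True
    then have "half_grad x = 0" by (simp add: half_grad_def)
    then show ?thesis by (simp add: Dn_def D_def)
  next
    case False
    have "(\<lambda>n. Dn n x) \<longlonglongrightarrow> ((norm (J x))\<^sup>2 - (norm (half_grad x))\<^sup>2 / ((norm (V x))\<^sup>2 + 0)) * (\<eta> x)\<^sup>2"
      unfolding Dn_def using False by (intro tendsto_intros eps0) auto
    then show ?thesis by (simp add: D_def)
  qed
  have meas: "Dn n \<in> borel_measurable lborel" for n
    using borel_measurable_continuous_onI[OF cont] by simp
  have measD: "D \<in> borel_measurable lborel"
    by (rule borel_measurable_LIMSEQ_real[OF lim meas])
  have bound: "\<bar>Dn n x\<bar> \<le> (norm (J x))\<^sup>2 * (\<eta> x)\<^sup>2" for n x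
  proof -
    have "(norm (half_grad x))\<^sup>2 \<le> (norm (J x))\<^sup>2 * ((norm (V x))\<^sup>2 + \<epsilon> n)"
      using norm_half_grad_le[of x] eps[of n] by (smt (verit) mult.commute mult_left_mono zero_le_power2)
    then have "(norm (half_grad x))\<^sup>2 / ((norm (V x))\<^sup>2 + \<epsilon> n) \<le> (norm (J x))\<^sup>2"
      using eps[of n] by (simp add: divide_le_eq add_nonneg_pos)
    moreover have "0 \<le> (norm (half_grad x))\<^sup>2 / ((norm (V x))\<^sup>2 + \<epsilon> n)"
      using eps[of n] by simp
    ultimately show ?thesis
      by (simp add: Dn_def abs_mult mult_right_mono)
  qed
  have intw: "integrable lborel (\<lambda>x. (norm (J x))\<^sup>2 * (\<eta> x)\<^sup>2)"
    by (rule integrable_continuous_bounded_support[OF _ S(1)]) (auto intro!: continuous_intros simp: S)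
  show "integrable lborel D"
    by (rule integrable_dominated_convergence[where s = Dn, OF measD meas intw]) (auto simp: lim bound)
  have "(\<lambda>n. LINT x|lborel. Dn n x) \<longlonglongrightarrow> (LINT x|lborel. D x)"
    by (rule integral_dominated_convergence[where s = Dn, OF measD meas intw]) (auto simp: lim bound)
  moreover have "(\<lambda>n. (LINT x|lborel. (norm (V x))\<^sup>2 * (norm (\<nu> x))\<^sup>2)
        + \<epsilon> n * (LINT x|lborel. (norm (\<nu> x))\<^sup>2 + c x * (\<eta> x)\<^sup>2))
     \<longlonglongrightarrow> (LINT x|lborel. (norm (V x))\<^sup>2 * (norm (\<nu> x))\<^sup>2)
        + 0 * (LINT x|lborel. (norm (\<nu> x))\<^sup>2 + c x * (\<eta> x)\<^sup>2)"
    by (intro tendsto_intros eps0)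
  ultimately show "(LINT x|lborel. D x) \<le> (LINT x|lborel. (norm (V x))\<^sup>2 * (norm (\<nu> x))\<^sup>2)"
    using regularised_inequality[OF assms(1) eps]
    by (auto intro: LIMSEQ_le simp: Dn_def)
qed

end

section \<open>A cutoff function\<close>

lemma DERIV_positive_part_squared: "((\<lambda>s. (max 0 s)\<^sup>2) has_real_derivative 2 * max 0 s) (at s)"
proof -
  consider "s < 0" | "s = 0" | "s > 0" by linarith
  then show ?thesis
  proof cases
    case 1
    have "((\<lambda>s. (max 0 s)\<^sup>2) has_real_derivative 0) (at s)"
      by (rule has_field_derivative_transform_within_open[where f = "\<lambda>s. 0" and S = "{..<0}"])
         (use 1 in auto)
    then show ?thesis using 1 by simp
  next
    case 2
    have "(\<lambda>h::real. max 0 h) \<midarrow>0\<rightarrow> max 0 0"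
      by (intro tendsto_intros)
    moreover have "(max 0 h)\<^sup>2 / h = max 0 h" if "h \<noteq> 0" for h :: real
      using that by (simp add: max_def power2_eq_square)
    ultimately have "(\<lambda>h. (max 0 h)\<^sup>2 / h) \<midarrow>0\<rightarrow> (0::real)"
      by (subst filterlim_cong[where g = "max 0"]) (auto simp: eventually_at_filter)
    then show ?thesis
      using 2 by (simp add: DERIV_def)
  next
    case 3
    have "((\<lambda>s. (max 0 s)\<^sup>2) has_real_derivative 2 * s) (at s)"
      by (rule has_field_derivative_transform_within_open[where f = "\<lambda>s. s\<^sup>2" and S = "{0<..}"])
         (use 3 in \<open>auto intro!: derivative_eq_intros\<close>)
    then show ?thesis using 3 by simp
  qed
qed

text \<open>
  The square of the positive part of a polynomial is of class \<open>C\<^sup>1\<close>, vanishes outside the ball of radius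
  \<open>R\<close>, and has a positive lower bound on smaller concentric balls.  Since the stability
  inequality is homogeneous of degree two in the cutoff, a lower bound on the smaller ball serves as well as the value \<open>1\<close>.
\<close>

definition cutoff :: "real \<Rightarrow> 'a::euclidean_space \<Rightarrow> real" where
  "cutoff R x = (max 0 (R\<^sup>2 - (norm x)\<^sup>2))\<^sup>2"

definition cutoff_grad :: "real \<Rightarrow> 'a::euclidean_space \<Rightarrow> 'a" where
  "cutoff_grad R x = (- 4 * max 0 (R\<^sup>2 - (norm x)\<^sup>2)) *\<^sub>R x"

lemma cutoff_outside:
  assumes "R > 0" "x \<notin> ball 0 R"
  shows "max 0 (R\<^sup>2 - (norm x)\<^sup>2) = 0"
  using assms by (simp add: max_def power_mono)

lemma test_function_cutoff:
  assumes "R > 0"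
  shows "test_function (cutoff R :: 'a::euclidean_space \<Rightarrow> real) (cutoff_grad R)"
  unfolding test_function_def
proof (intro conjI allI)
  fix x :: 'a
  have "GDERIV (\<lambda>x. R\<^sup>2 - (norm x)\<^sup>2) x :> - 2 *\<^sub>R x"
    unfolding gderiv_def power2_norm_eq_inner
    by (auto intro!: derivative_eq_intros simp: inner_commute)
  from GDERIV_DERIV_compose[OF this DERIV_positive_part_squared]
  show "GDERIV (cutoff R) x :> cutoff_grad R x"
    by (simp add: cutoff_def [abs_def] cutoff_grad_def)
  show "continuous_on UNIV (cutoff_grad R :: 'a \<Rightarrow> 'a)"
    unfolding cutoff_grad_def [abs_def] by (intro continuous_intros)
  have "{x::'a. cutoff R x \<noteq> 0} \<subseteq> ball 0 R"
    using cutoff_outside[OF assms] by (fastforce simp: cutoff_def simp del: mem_ball)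
  then show "bounded {x::'a. cutoff R x \<noteq> 0}"
    by (rule bounded_subset[OF bounded_ball])
qed

lemma cutoff_lower_bound:
  assumes "R > 0" "x \<in> ball 0 R"
  shows "81 * R ^ 8 \<le> (cutoff (2 * R) x)\<^sup>2"
proof -
  have "(norm x)\<^sup>2 \<le> R\<^sup>2"
    using assms by (intro power_mono) auto
  then have "3 * R\<^sup>2 \<le> max 0 ((2 * R)\<^sup>2 - (norm x)\<^sup>2)"
    by (simp add: power_mult_distrib)
  then have "(3 * R\<^sup>2) ^ 4 \<le> (max 0 ((2 * R)\<^sup>2 - (norm x)\<^sup>2)) ^ 4"
    by (intro power_mono) auto
  then show ?thesis
    by (simp add: cutoff_def power_mult_distrib flip: power_mult)
qed

lemma cutoff_grad_upper_bound:
  assumes "R > 0"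
  shows "(norm (cutoff_grad (2 * R) x))\<^sup>2 \<le> 1024 * R ^ 6 * indicator (ball 0 (2 * R)) x"
proof (cases "x \<in> ball 0 (2 * R)")
  case True
  let ?m = "max 0 ((2 * R)\<^sup>2 - (norm x)\<^sup>2)"
  have "?m \<le> 4 * R\<^sup>2"
    by (simp add: power_mult_distrib)
  then have "?m\<^sup>2 \<le> (4 * R\<^sup>2)\<^sup>2"
    by (intro power_mono) auto
  moreover have "(norm x)\<^sup>2 \<le> (2 * R)\<^sup>2"
    using True by (intro power_mono) auto
  ultimately have "16 * (?m\<^sup>2 * (norm x)\<^sup>2) \<le> 16 * ((4 * R\<^sup>2)\<^sup>2 * (2 * R)\<^sup>2)"
    by (intro mult_left_mono mult_mono) auto
  also have "\<dots> = 1024 * R ^ 6"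
    by (simp add: power_mult_distrib flip: power_mult power_add)
  finally show ?thesis
    using True by (simp add: cutoff_grad_def power_mult_distrib)
next
  case False
  then show ?thesis
    using cutoff_outside[of "2 * R" x] assms by (simp add: cutoff_grad_def del: mem_ball)
qed

section \<open>The Allen--Cahn equation\<close>

lemma grad_eq:
  assumes "GDERIV f x :> g"
  shows "grad f x = g"
  using GDERIV_unique[OF GDERIV_grad assms] assms
  by (auto simp: gderiv_def differentiable_def)

lemma C1_compact_test_function:
  assumes "test_function \<xi> \<zeta>"
  shows "C1_compact \<xi>" and "grad \<xi> = \<zeta>"
proof -
  show grad: "grad \<xi> = \<zeta>"
    using grad_eq[OF test_functionD(1)[OF assms]] by auto
  have "\<xi> differentiable at x" for x
    using test_functionD(1)[OF assms, of x] by (auto simp: gderiv_def differentiable_def)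
  then show "C1_compact \<xi>"
    using assms grad by (auto simp: C1_compact_def C1_def test_function_def)
qed

lemma stable_on_RnD:
  assumes "stable_on_Rn u" and "test_function \<xi> \<zeta>"
  shows "(LINT x|lborel. (norm (\<zeta> x))\<^sup>2 + deriv (deriv W) (u x) * (\<xi> x)\<^sup>2) \<ge> 0"
  using assms C1_compact_test_function[OF assms(2)] unfolding stable_on_Rn_def by blast

lemma jacobian_eq:
  fixes V :: "real ^ 'n \<Rightarrow> real ^ 'm"
  assumes "(V has_derivative (\<lambda>h. A *v h)) (at x)"
  shows "jacobian V (at x) = A"
  by (simp add: jacobian_def matrix_of_matrix_vector_mul flip: frechet_derivative_at[OF assms])

lemma allen_cahn_semilinear:
  fixes u :: "real ^ 'n \<Rightarrow> real"
  assumes "allen_cahn_solution u"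
  shows "semilinear_solution u (grad u) (\<lambda>x. jacobian (grad u) (at x)) (deriv W) (deriv (deriv W))"
proof
  fix x :: "real ^ 'n" and s :: real
  show "GDERIV u x :> grad u x"
    using assms by (intro GDERIV_grad) (auto simp: allen_cahn_solution_def C2_def)
  show "(grad u has_derivative (\<lambda>h. jacobian (grad u) (at x) *v h)) (at x)"
    using assms by (auto simp: allen_cahn_solution_def C2_def simp flip: jacobian_works)
  show "continuous_on UNIV (\<lambda>x. jacobian (grad u) (at x))"
    using assms by (auto simp: allen_cahn_solution_def C2_def)
  show "(deriv W has_real_derivative deriv (deriv W) s) (at s)"
    unfolding deriv_deriv_W unfolding deriv_W by (auto intro!: derivative_eq_intros)
  show "continuous_on UNIV (deriv (deriv W))"
    unfolding deriv_deriv_W [abs_def] by (intro continuous_intros)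
  have "- laplacian u x + deriv W (u x) = 0"
    using assms by (auto simp: allen_cahn_solution_def)
  then show "trace (jacobian (grad u) (at x)) = deriv W (u x)"
    by (simp add: laplacian_def)
qed

text \<open>
  The differential of \<^const>\<open>grad_perp\<close>, written row by row: the \<open>i\<close>-th component of \<open>grad_perp e u\<close> is the
  derivative of \<open>u\<close> in direction \<open>e\<^sub>i - (e \<bullet> e\<^sub>i) e\<close>, so its gradient is the Hessian applied to that
  direction.
\<close>

definition jacobian_perp :: "real ^ 'n \<Rightarrow> (real ^ 'n \<Rightarrow> real) \<Rightarrow> real ^ 'n \<Rightarrow> real ^ 'n ^ 'n" where
  "jacobian_perp e u x = (\<chi> i. jacobian (grad u) (at x) *v (axis i 1 - (e $ i) *\<^sub>R e))"

lemma grad_perp_nth: "grad_perp e u x $ i = grad u x \<bullet> (axis i 1 - (e $ i) *\<^sub>R e)"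
  by (simp add: grad_perp_def inner_diff_right inner_axis inner_commute)

lemma linearised_system_grad_perp:
  fixes u :: "real ^ 'n \<Rightarrow> real"
  assumes sol: "allen_cahn_solution u" and stab: "stable_on_Rn u"
  shows "linearised_system (grad_perp e u) (jacobian_perp e u) (\<lambda>x. deriv (deriv W) (u x))"
proof -
  interpret semilinear_solution u "grad u" "\<lambda>x. jacobian (grad u) (at x)" "deriv W" "deriv (deriv W)"
    by (rule allen_cahn_semilinear[OF sol])
  show ?thesis
  proof
    fix x
    have "(grad_perp e u has_derivative
             (\<lambda>h. jacobian (grad u) (at x) *v h - (e \<bullet> (jacobian (grad u) (at x) *v h)) *\<^sub>R e)) (at x)"
      unfolding grad_perp_def [abs_def]
      by (rule derivative_eq_intros hess refl)+ simp
    also have "(\<lambda>h. jacobian (grad u) (at x) *v h - (e \<bullet> (jacobian (grad u) (at x) *v h)) *\<^sub>R e)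
        = (\<lambda>h. jacobian_perp e u x *v h)"
    proof
      fix h
      have "(jacobian_perp e u x *v h) $ i = (jacobian (grad u) (at x) *v h) \<bullet> (axis i 1 - (e $ i) *\<^sub>R e)" for i
        using sym_H_inner by (simp add: jacobian_perp_def matrix_vector_mul_component)
      then show "jacobian (grad u) (at x) *v h - (e \<bullet> (jacobian (grad u) (at x) *v h)) *\<^sub>R e
        = jacobian_perp e u x *v h"
        by (simp add: vec_eq_iff inner_diff_right inner_axis inner_commute[of _ e])
    qed
    finally show "(grad_perp e u has_derivative (\<lambda>h. jacobian_perp e u x *v h)) (at x)" .
  next
    show "continuous_on UNIV (jacobian_perp e u)"
      unfolding jacobian_perp_def [abs_def] by (intro continuous_intros cont_H)
    show "continuous_on UNIV (\<lambda>x. deriv (deriv W) (u x))"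
      by (rule continuous_on_compose2[OF cont_f' cont_u]) auto
  next
    fix \<phi> :: "real ^ 'n \<Rightarrow> real" and \<psi> and i :: 'n
    assume "test_function \<phi> \<psi>"
    from weak_linearised_equation[OF this]
    show "(LINT x|lborel. jacobian_perp e u x $ i \<bullet> \<psi> x + deriv (deriv W) (u x) * grad_perp e u x $ i * \<phi> x) = 0"
      by (simp add: jacobian_perp_def grad_perp_nth)
  qed (rule stable_on_RnD[OF stab])
qed

lemma (in linearised_system) jacobian_V: "jacobian V (at x) = J x"
  by (rule jacobian_eq[OF deriv_V])

lemma (in linearised_system) norm_grad_norm_V:
  assumes "V x \<noteq> 0"
  shows "(norm (grad (\<lambda>y. norm (V y)) x))\<^sup>2 = (norm (half_grad x))\<^sup>2 / (norm (V x))\<^sup>2"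
  unfolding grad_eq[OF GDERIV_norm_comp[OF deriv_V assms]] half_grad_def
  by (simp add: power_divide power_mult_distrib)

lemma norm_grad_perp_squared:
  assumes "norm e = 1"
  shows "(norm (grad_perp e u x))\<^sup>2 = (norm (grad u x))\<^sup>2 - (e \<bullet> grad u x)\<^sup>2"
proof -
  have "e \<bullet> e = 1" using assms by (simp add: norm_eq_1)
  then show ?thesis
    unfolding grad_perp_def power2_norm_eq_inner
    by (simp add: inner_diff_left inner_diff_right inner_commute power2_eq_square)
qed

text \<open>
  The stability inequality for \<open>grad_perp e u\<close> with the cutoff of radius \<open>2 R\<close>.  Where \<open>grad_perp e u\<close>
  does not vanish, \<open>A2\<close> times the squared length of the gradient is the integrand of that
  inequality; elsewhere it is \<open>0\<close>, and the integrand is nonnegative.  The cutoff squared is at least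
  \<open>81 R\<^sup>8\<close> on the ball of radius \<open>R\<close>, its squared gradient at most \<open>1024 R\<^sup>6\<close> on the ball of radius
  \<open>2 R\<close>.
\<close>

lemma curvature_integral_le:
  assumes sol: "allen_cahn_solution u" and stab: "stable_on_Rn u" and e: "norm e = 1" and R: "R > 0"
  shows "81 * R ^ 8 * (LINT x:ball 0 R|lborel. A2 e u x * (norm (grad u x))\<^sup>2)
    \<le> 1024 * R ^ 6 * (LINT x:ball 0 (2 * R)|lborel. (norm (grad u x))\<^sup>2 - (e \<bullet> grad u x)\<^sup>2)"
proof -
  interpret linearised_system "grad_perp e u" "jacobian_perp e u" "\<lambda>x. deriv (deriv W) (u x)"
    by (rule linearised_system_grad_perp[OF sol stab])
  let ?V = "grad_perp e u" and ?\<eta> = "cutoff (2 * R)" and ?\<nu> = "cutoff_grad (2 * R)"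
  have test: "test_function ?\<eta> ?\<nu>"
    using R by (intro test_function_cutoff) simp
  let ?E = "\<lambda>x. (norm (jacobian_perp e u x))\<^sup>2 - (norm (half_grad x))\<^sup>2 / (norm (?V x))\<^sup>2"
  have E: "0 \<le> ?E x" for x
    using norm_half_grad_le[of x] by (cases "?V x = 0") (auto simp: divide_le_eq mult.commute)
  have A2: "A2 e u x * (norm (grad u x))\<^sup>2 \<le> ?E x" for x
  proof (cases "?V x = 0")
    case True
    then show ?thesis using E[of x] by (simp add: A2_def)
  next
    case False
    then have "grad u x \<noteq> 0" by (auto simp: grad_perp_def)
    with False show ?thesis
      by (simp add: A2_def jacobian_V norm_grad_norm_V)
  qed
  have "81 * R ^ 8 * (LINT x:ball 0 R|lborel. A2 e u x * (norm (grad u x))\<^sup>2)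
      = (LINT x|lborel. 81 * R ^ 8 * (indicator (ball 0 R) x *\<^sub>R (A2 e u x * (norm (grad u x))\<^sup>2)))"
    by (simp add: set_lebesgue_integral_def)
  \<comment> \<open>A nonintegrable left integrand would have integral \<open>0\<close>, so the right integrand is also shown to be nonnegative.\<close>
  also have "\<dots> \<le> (LINT x|lborel. ?E x * (?\<eta> x)\<^sup>2)"
  proof (rule integral_mono')
    show "integrable lborel (\<lambda>x. ?E x * (?\<eta> x)\<^sup>2)"
      by (rule stability_inequality(1)[OF test])
    show "81 * R ^ 8 * (indicator (ball 0 R) x *\<^sub>R (A2 e u x * (norm (grad u x))\<^sup>2)) \<le> ?E x * (?\<eta> x)\<^sup>2" for x
    proof (cases "x \<in> ball 0 R")
      case True
      have "81 * R ^ 8 * (A2 e u x * (norm (grad u x))\<^sup>2) \<le> 81 * R ^ 8 * ?E x"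
        using A2 R by (intro mult_left_mono) auto
      also have "\<dots> \<le> (?\<eta> x)\<^sup>2 * ?E x"
        by (rule mult_right_mono[OF cutoff_lower_bound[OF R True] E])
      finally show ?thesis using True by (simp add: mult.commute)
    qed (use E[of x] in simp)
    show "0 \<le> ?E x * (?\<eta> x)\<^sup>2" for x
      using E[of x] by simp
  qed
  also have "\<dots> \<le> (LINT x|lborel. (norm (?V x))\<^sup>2 * (norm (?\<nu> x))\<^sup>2)"
    by (rule stability_inequality(2)[OF test])
  also have "\<dots> \<le> (LINT x|lborel. 1024 * R ^ 6 * (indicator (ball 0 (2 * R)) x *\<^sub>R (norm (?V x))\<^sup>2))"
  proof (rule integral_mono')
    have "set_integrable lborel (cball 0 (2 * R)) (\<lambda>x. (norm (?V x))\<^sup>2)"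
      unfolding set_integrable_def
      by (intro borel_integrable_compact compact_cball continuous_intros continuous_on_subset[OF cont_V] subset_UNIV)
    then have "set_integrable lborel (ball 0 (2 * R)) (\<lambda>x. (norm (?V x))\<^sup>2)"
      by (rule set_integrable_subset) auto
    then show "integrable lborel (\<lambda>x. 1024 * R ^ 6 * (indicator (ball 0 (2 * R)) x *\<^sub>R (norm (?V x))\<^sup>2))"
      by (simp add: set_integrable_def)
    show "(norm (?V x))\<^sup>2 * (norm (?\<nu> x))\<^sup>2 \<le> 1024 * R ^ 6 * (indicator (ball 0 (2 * R)) x *\<^sub>R (norm (?V x))\<^sup>2)" for x
      using mult_left_mono[OF cutoff_grad_upper_bound[OF R, of x], of "(norm (?V x))\<^sup>2"] by (simp add: mult_ac)
    show "0 \<le> 1024 * R ^ 6 * (indicator (ball 0 (2 * R)) x *\<^sub>R (norm (?V x))\<^sup>2)" for x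
      using R by simp
  qed
  also have "\<dots> = 1024 * R ^ 6 * (LINT x:ball 0 (2 * R)|lborel. (norm (grad u x))\<^sup>2 - (e \<bullet> grad u x)\<^sup>2)"
    by (simp add: set_lebesgue_integral_def norm_grad_perp_squared[OF e])
  finally show ?thesis .
qed

text \<open>
  The factor \<open>2\<^sup>n\<^sup>-\<^sup>1\<close> in the constant converts the scaling by \<open>2 R\<close> in \<open>T2\<close> into a scaling by \<open>R\<close>; the
  rest is the ratio of the two bounds on the cutoff.
\<close>

theorem proposition3p14:
  "\<exists>C::real. \<forall>(u :: real ^ 'n \<Rightarrow> real) (e :: real ^ 'n) (R :: real).
     allen_cahn_solution u \<and> stable_on_Rn u \<and> e \<in> sphere 0 1 \<and> R > 0 \<longrightarrow>
     K2 R u e \<le> C * T2 (2 * R) u e"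
proof (rule exI[of _ "1024 / 81 * 2 powi (int CARD('n) - 1)"], intro allI impI)
  fix u :: "real ^ 'n \<Rightarrow> real" and e :: "real ^ 'n" and R :: real
  assume asm: "allen_cahn_solution u \<and> stable_on_Rn u \<and> e \<in> sphere 0 1 \<and> R > 0"
  then have R: "R > 0" by blast
  let ?k = "int CARD('n) - 3"
  let ?I = "LINT x:ball 0 R|lborel. A2 e u x * (norm (grad u x))\<^sup>2"
  let ?T = "LINT x:ball 0 (2 * R)|lborel. (norm (grad u x))\<^sup>2 - (e \<bullet> grad u x)\<^sup>2"
  have "81 * R ^ 8 * ?I \<le> 1024 * R ^ 6 * ?T"
    using asm by (intro curvature_integral_le) auto
  then have "R ^ 6 * (81 * R\<^sup>2 * ?I) \<le> R ^ 6 * (1024 * ?T)"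
    by (simp add: mult_ac flip: power_add)
  then have "81 * R\<^sup>2 * ?I \<le> 1024 * ?T"
    using R by simp
  then have I: "?I \<le> 1024 / 81 * (?T / R\<^sup>2)"
    using R by (simp add: field_simps)
  have shift: "r powi (int CARD('n) - 1) = r powi ?k * r\<^sup>2" if "r > 0" for r :: real
    using power_int_add[of r ?k 2] that by simp
  have "K2 R u e = ?I / R powi ?k"
    by (simp add: K2_def)
  also have "\<dots> \<le> 1024 / 81 * (?T / R\<^sup>2) / R powi ?k"
    using I R by (intro divide_right_mono) auto
  also have "\<dots> = 1024 / 81 * 2 powi (int CARD('n) - 1) * T2 (2 * R) u e"
    unfolding T2_def power_int_mult_distrib using R by (simp add: shift)
  finally show "K2 R u e \<le> 1024 / 81 * 2 powi (int CARD('n) - 1) * T2 (2 * R) u e" .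
qed

end
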